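(* Let $A,B,C$ be three logically independent events and let $(x,y,t)\in[0,1]^3$ be a (coherent) assessment on the sequence of conditional events $(C|B,\ A|B,\ B|(A\vee B))$. Then the extension $z=p(C|A)$ of $(x,y,t)$ is coherent (i.e. the assessment $(x,y,t,z)$ on $(C|B,A|B,B|(A\vee B),C|A)$ is coherent) if and only if $z\in[z',z'']$, where \[ z'=\begin{cases}0, & \text{if } t(x+y-1)\le 0,\\[2pt] \dfrac{t(x+y-1)}{1-t(1-y)}, & \text{if } t(x+y-1)>0,\end{cases} \qquad z''=\begin{cases}1, & \text{if } t(y-x)\le 0,\\[2pt] 1-\dfrac{t(y-x)}{1-t(1-y)}, & \text{if } t(y-x)>0.\end{cases} \]
   Context: Events are elements of a Boolean algebra (e.g. subsets of a set $\Omega$), identified with their $\{0,1\}$-valued indicators; $\overline{E}$ is the negation of $E$ and juxtaposition or $\wedge$ is conjunction. Events $A,B,C$ are logically independent if all $8$ conjunctions obtained by choosing each of them or its negation are different from the impossible event $\bot$. For events $E,H$ with $H\ne\bot$, the conditional event $E|H$ is true if $EH$ is true, false if $\overline{E}H$ is true, and void if $H$ is false. Coherence: an assessment $\mathcal P=(p_1,\dots,p_n)\in\mathbb R^n$ on $\mathcal F=(E_1|H_1,\dots,E_n|H_n)$ is coherent if for every nonempty $J\subseteq\{1,\dots,n\}$ and all real numbers $s_j$ ($j\in J$), the random gain $G=\sum_{j\in J}s_jH_j(E_j-p_j)$, restricted to $\bigvee_{j\in J}H_j$ (i.e. considering only its values when at least one $H_j$, $j\in J$, is true), has minimum $\le 0$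 and maximum $\ge 0$. No positivity of the probability of conditioning events is assumed. The word "(coherent)" in the claim is not an extra restriction: every $(x,y,t)\in[0,1]^3$ on $(C|B,A|B,B|(A\vee B))$ is coherent. *)

theory Defs
  imports Complex_Main
begin

definition logically_independent3 :: "'a::boolean_algebra \<Rightarrow> 'a \<Rightarrow> 'a \<Rightarrow> bool" where
  "logically_independent3 A B C \<longleftrightarrow>
     (\<forall>a\<in>{A, - A}. \<forall>b\<in>{B, - B}. \<forall>c\<in>{C, - C}. inf (inf a b) c \<noteq> bot)"

text \<open>The term \<open>E given H\<close> stands for $E|H$. The requirement $H \neq \bot$ is part of
  \<open>coherent\<close> below.\<close>

datatype 'a cond_event = Given (consequent: 'a) (antecedent: 'a)  (infix "given" 55)

text \<open>In an abstract Boolean algebra there are no points at which to evaluate indicators. The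
  elementary cases are instead the constituents of the finitely many events involved, i.e. the
  conjunctions different from \<open>bot\<close> obtained by taking each event or its negation. An event
  is true in a constituent \<open>K\<close> iff \<open>K \<le> E\<close>, and false iff \<open>K \<le> - E\<close>.\<close>

fun constituents :: "'a::boolean_algebra list \<Rightarrow> 'a set" where
  "constituents [] = {top} - {bot}"
| "constituents (E # Es) = (inf E ` constituents Es \<union> inf (- E) ` constituents Es) - {bot}"

definition ind :: "'a::boolean_algebra \<Rightarrow> 'a \<Rightarrow> real" where
  "ind E K = of_bool (K \<le> E)"

definition family_constituents :: "'a::boolean_algebra cond_event list \<Rightarrow> 'a set" where
  "family_constituents F = constituents (map consequent F @ map antecedent F)"

definition gain ::
  "'a::boolean_algebra cond_event list \<Rightarrow> real list \<Rightarrow> nat set \<Rightarrow> (nat \<Rightarrow> real) \<Rightarrow> 'a \<Rightarrow> real" where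
  "gain F P J s K =
     (\<Sum>j\<in>J. s j * ind (antecedent (F ! j)) K * (ind (consequent (F ! j)) K - P ! j))"

definition gain_values ::
  "'a::boolean_algebra cond_event list \<Rightarrow> real list \<Rightarrow> nat set \<Rightarrow> (nat \<Rightarrow> real) \<Rightarrow> real set" where
  "gain_values F P J s =
     gain F P J s ` {K \<in> family_constituents F. \<exists>j\<in>J. K \<le> antecedent (F ! j)}"

definition coherent :: "'a::boolean_algebra cond_event list \<Rightarrow> real list \<Rightarrow> bool" where
  "coherent F P \<longleftrightarrow>
     length P = length F \<and>
     (\<forall>X\<in>set F. antecedent X \<noteq> bot) \<and>
     (\<forall>J s. J \<noteq> {} \<and> J \<subseteq> {..<length F} \<longrightarrow>
        Min (gain_values F P J s) \<le> 0 \<and> 0 \<le> Max (gain_values F P J s))"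

definition lower_ext :: "real \<Rightarrow> real \<Rightarrow> real \<Rightarrow> real" where
  "lower_ext x y t =
     (if t * (x + y - 1) \<le> 0 then 0 else t * (x + y - 1) / (1 - t * (1 - y)))"

definition upper_ext :: "real \<Rightarrow> real \<Rightarrow> real \<Rightarrow> real" where
  "upper_ext x y t =
     (if t * (y - x) \<le> 0 then 1 else 1 - t * (y - x) / (1 - t * (1 - y)))"

text \<open>The minimum and maximum in \<open>coherent\<close> are those of a finite nonempty set.\<close>

lemma finite_constituents: "finite (constituents Es)"
  by (induction Es) auto

lemma constituents_refine:
  "x \<noteq> bot \<Longrightarrow> \<exists>K\<in>constituents Es. inf x K \<noteq> bot"
proof (induction Es arbitrary: x)
  case Nil
  then have "top \<noteq> (bot::'a)" by (metis inf_top_right inf_bot_right)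
  then show ?case using Nil by simp
next
  case (Cons E Es)
  have "x = sup (inf x E) (inf x (- E))"
    by (metis inf_sup_distrib1 inf_top_right sup_compl_top)
  then have "inf x E \<noteq> bot \<or> inf x (- E) \<noteq> bot" using Cons.prems by (metis sup_bot_left)
  then obtain e where e: "e = E \<or> e = - E" "inf x e \<noteq> bot" by blast
  obtain K where K: "K \<in> constituents Es" "inf (inf x e) K \<noteq> bot"
    using Cons.IH[OF e(2)] by blast
  then have "inf x (inf e K) \<noteq> bot" by (simp add: inf.assoc)
  moreover from this have "inf e K \<in> constituents (E # Es)" using K(1) e(1) by auto
  ultimately show ?case by blast
qed

lemma constituents_decide:
  "K \<in> constituents Es \<Longrightarrow> E \<in> set Es \<Longrightarrow> K \<le> E \<or> K \<le> - E"
  by (induction Es arbitrary: K) (auto intro: le_infI2)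

lemma constituents_not_bot: "K \<in> constituents Es \<Longrightarrow> K \<noteq> bot"
  by (cases Es) auto

lemma finite_gain_values: "finite (gain_values F P J s)"
  by (simp add: gain_values_def family_constituents_def finite_constituents)

lemma gain_values_nonempty:
  assumes "j \<in> J" "j < length F" "antecedent (F ! j) \<noteq> bot"
  shows "gain_values F P J s \<noteq> {}"
proof -
  obtain K where K: "K \<in> family_constituents F" "inf (antecedent (F ! j)) K \<noteq> bot"
    using constituents_refine[OF assms(3)] unfolding family_constituents_def by blast
  have "K \<le> antecedent (F ! j) \<or> K \<le> - antecedent (F ! j)"
    using K(1) assms(2) unfolding family_constituents_def
    by (intro constituents_decide) auto
  then have "K \<le> antecedent (F ! j)"
    using K(2) by (metis inf.commute inf_shunt double_compl)
  then show ?thesis using K(1) assms(1) unfolding gain_values_def by blast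
qed

text \<open>For subsets of a sample space, the values are the pointwise ones.\<close>

lemma gain_values_sets:
  fixes F :: "'w set cond_event list"
  assumes "J \<subseteq> {..<length F}"
  shows "gain_values F P J s =
    (\<lambda>w. \<Sum>j\<in>J. s j * of_bool (w \<in> antecedent (F ! j)) * (of_bool (w \<in> consequent (F ! j)) - P ! j))
      ` (\<Union>j\<in>J. antecedent (F ! j))"
    (is "_ = ?g ` _")
proof -
  have mem: "K \<le> E \<longleftrightarrow> w \<in> E"
    if "K \<in> family_constituents F" "w \<in> K" "E \<in> consequent ` set F \<union> antecedent ` set F" for K E w
    using constituents_decide[of K "map consequent F @ map antecedent F" E] that
    unfolding family_constituents_def by auto
  have inF: "j < length F" if "j \<in> J" for j using that assms by auto
  have gain_eq: "gain F P J s K = ?g w" if "K \<in> family_constituents F" "w \<in> K" for K w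
    unfolding gain_def ind_def using mem[OF that] inF by (intro sum.cong) auto
  have ante: "(\<exists>j\<in>J. K \<le> antecedent (F ! j)) \<longleftrightarrow> w \<in> (\<Union>j\<in>J. antecedent (F ! j))"
    if "K \<in> family_constituents F" "w \<in> K" for K w
    using mem[OF that] inF by auto
  show ?thesis
  proof (intro set_eqI iffI)
    fix v assume "v \<in> gain_values F P J s"
    then obtain K where K: "K \<in> family_constituents F" "\<exists>j\<in>J. K \<le> antecedent (F ! j)"
      "v = gain F P J s K" unfolding gain_values_def by blast
    moreover obtain w where "w \<in> K"
      using K(1) constituents_not_bot unfolding family_constituents_def by blast
    ultimately show "v \<in> ?g ` (\<Union>j\<in>J. antecedent (F ! j))"
      using ante gain_eq by blast
  next
    fix v assume "v \<in> ?g ` (\<Union>j\<in>J. antecedent (F ! j))"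
    then obtain w where w: "w \<in> (\<Union>j\<in>J. antecedent (F ! j))" "v = ?g w" by blast
    obtain K where K: "K \<in> family_constituents F" "w \<in> K"
      using constituents_refine[of "{w}" "map consequent F @ map antecedent F"]
      unfolding family_constituents_def by auto
    have "v = gain F P J s K" using w(2) gain_eq[OF K] by simp
    then show "v \<in> gain_values F P J s"
      using K(1) ante[OF K] w(1) unfolding gain_values_def by blast
  qed
qed

end

theory Submission
  imports Defs
begin

text \<open>Both directions rest on the duality between gains and probabilities.

  If a probability distribution on the constituents inside $\bigvee_{j \in J} H_j$ gives every
  $H_j(E_j - p_j)$ with $j \in J$ the mean $0$, then every gain on $J$ has mean $0$ and
  so takes a value $\le 0$ and a value $\ge 0$ (\<open>gain_sign_if_mean_zero\<close>).
  For the present family, a distribution on $A \vee B$ with $P(B) = t$ that makes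
  $A$ and $C$ have probabilities $y$ and $x$ given $B$ is
  determined by $q = P(AC | B)$ and $r = P(C | A\overline{B})$, and it gives $C|A$ the
  probability $z$ iff $tq + (1-t)r = z(1 - t + ty)$. The number $q$ ranges over the Frechet
  interval $[\max(0, x+y-1), \min(x,y)]$ and $r$ over $[0,1]$, so the solvable $z \in [0,1]$ are
  those with
  \[ t(x+y-1) \le z(1-t+ty) \le 1-t+tx, \]
  which is the interval of the theorem, also when the coefficient of $z$ vanishes
  (\<open>in_extension_interval_iff\<close>). As events of probability zero may be conditioned
  on, the sets $J$ with a smaller union of antecedents need their own distributions: one on $B$
  for $J \subseteq \{C|B, A|B\}$, one on $A\overline{B}$ for $J = \{C|A\}$. They are the extreme
  cases $t = 1$ and $t = 0$ of the same formula.

  Conversely, $0 \le z \le 1$ comes from bets on $C|A$ alone, and the two inequalities come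
  from the pointwise inequalities $AC \ge BC + AB - B$ and $AC \le BC + 1 - B$ on
  $A \vee B$. Replacing each conjunction by its price turns the difference of
  the two sides into a gain plus a constant; if the constant were negative, that
  gain would be positive throughout.\<close>

section \<open>Constituents\<close>

lemma constituent_not_le_iff:
  assumes "K \<in> constituents Es" and "E \<in> set Es"
  shows "\<not> K \<le> E \<longleftrightarrow> K \<le> - E"
  using constituents_decide[OF assms] constituents_not_bot[OF assms(1)]
  by (metis inf.absorb_iff1 inf_shunt)

lemma constituent_le_sup_iff:
  assumes "K \<in> constituents Es" and "E \<in> set Es"
  shows "K \<le> sup E E' \<longleftrightarrow> K \<le> E \<or> K \<le> E'"
proof
  assume le: "K \<le> sup E E'"
  show "K \<le> E \<or> K \<le> E'"
  proof (rule disjCI)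
    assume "\<not> K \<le> E'"
    show "K \<le> E"
    proof (rule ccontr)
      assume "\<not> K \<le> E"
      then have "K \<le> inf (- E) (sup E E')"
        using le constituent_not_le_iff[OF assms] by simp
      then have "K \<le> E'" by (simp add: inf_sup_distrib1)
      with \<open>\<not> K \<le> E'\<close> show False by contradiction
    qed
  qed
qed (auto intro: le_supI1 le_supI2)

text \<open>Logical independence makes all eight truth patterns occur: the conjunction with a given
  pattern meets some constituent, and a constituent that decides the three events lies inside
  every one that it meets.\<close>

lemma constituent_with_pattern:
  assumes ind: "logically_independent3 A B C" and "{A, B, C} \<subseteq> set Es"
  obtains K where "K \<in> constituents Es" "K \<le> A \<longleftrightarrow> a" "K \<le> B \<longleftrightarrow> b" "K \<le> C \<longleftrightarrow> c"
proof -
  define lit where "lit v E = (if v then E else - E)" for v and E :: 'a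
  have "inf (inf (lit a A) (lit b B)) (lit c C) \<noteq> bot"
    using ind unfolding logically_independent3_def lit_def by simp
  then obtain K where K: "K \<in> constituents Es"
      and meets: "inf (inf (inf (lit a A) (lit b B)) (lit c C)) K \<noteq> bot" (is "?m \<noteq> bot")
    using constituents_refine by blast
  have decide: "K \<le> E \<longleftrightarrow> v" if "E \<in> set Es" "inf (lit v E) K \<noteq> bot" for v E
    using that constituent_not_le_iff[OF K that(1)] unfolding lit_def
    by (cases v) (auto simp: inf_shunt inf.commute[of _ K])
  have "?m \<le> inf (lit a A) K" "?m \<le> inf (lit b B) K" "?m \<le> inf (lit c C) K"
    by (auto intro: le_infI1 le_infI2)
  then have "inf (lit a A) K \<noteq> bot" "inf (lit b B) K \<noteq> bot" "inf (lit c C) K \<noteq> bot"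
    using meets by (metis bot_unique)+
  then show thesis using that[OF K] decide assms(2) by auto
qed

section \<open>Coherence and mean values of gains\<close>

lemma coherent_gain_not_positive:
  assumes "coherent F P" and "J \<noteq> {}" and "J \<subseteq> {..<length F}"
  obtains K where "K \<in> family_constituents F" "\<exists>j\<in>J. K \<le> antecedent (F ! j)"
    "gain F P J s K \<le> 0"
proof -
  obtain j where "j \<in> J" using assms(2) by blast
  then have "j < length F" using assms(3) by auto
  then have "antecedent (F ! j) \<noteq> bot" using assms(1) unfolding coherent_def by auto
  then have "gain_values F P J s \<noteq> {}"
    using gain_values_nonempty \<open>j \<in> J\<close> \<open>j < length F\<close> by blast
  then have "Min (gain_values F P J s) \<in> gain_values F P J s"
    by (rule Min_in[OF finite_gain_values])
  moreover have "Min (gain_values F P J s) \<le> 0" using assms unfolding coherent_def by blast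
  ultimately show thesis using that unfolding gain_values_def by force
qed

text \<open>By linearity the gain itself has mean $0$, and a mean lies between the minimum and the
  maximum. The weights are indexed by a set of their own, so that they can be put on chosen
  constituents without enumerating all of them.\<close>

lemma gain_sign_if_mean_zero:
  fixes w :: "'i \<Rightarrow> real" and \<kappa> :: "'i \<Rightarrow> 'a::boolean_algebra"
  assumes "finite I"
    and nonneg: "\<And>i. i \<in> I \<Longrightarrow> 0 \<le> w i" and total: "sum w I = 1"
    and const: "\<And>i. i \<in> I \<Longrightarrow> \<kappa> i \<in> family_constituents F"
    and supp: "\<And>i. i \<in> I \<Longrightarrow> w i \<noteq> 0 \<Longrightarrow> \<exists>j\<in>J. \<kappa> i \<le> antecedent (F ! j)"
    and mean: "\<And>j. j \<in> J \<Longrightarrow>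
      (\<Sum>i\<in>I. w i * (ind (antecedent (F ! j)) (\<kappa> i) * (ind (consequent (F ! j)) (\<kappa> i) - P ! j))) = 0"
  shows "Min (gain_values F P J s) \<le> 0 \<and> 0 \<le> Max (gain_values F P J s)"
proof -
  let ?g = "gain F P J s" and ?V = "gain_values F P J s"
  have "(\<Sum>i\<in>I. w i * ?g (\<kappa> i)) =
      (\<Sum>i\<in>I. \<Sum>j\<in>J. s j * (w i * (ind (antecedent (F ! j)) (\<kappa> i) *
        (ind (consequent (F ! j)) (\<kappa> i) - P ! j))))"
    unfolding gain_def by (simp add: sum_distrib_left mult_ac)
  also have "\<dots> = (\<Sum>j\<in>J. s j * (\<Sum>i\<in>I. w i * (ind (antecedent (F ! j)) (\<kappa> i) *
        (ind (consequent (F ! j)) (\<kappa> i) - P ! j))))"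
    by (subst sum.swap) (simp add: sum_distrib_left)
  also have "\<dots> = 0" using mean by simp
  finally have zero: "(\<Sum>i\<in>I. w i * ?g (\<kappa> i)) = 0" .
  have "Min ?V \<le> ?g (\<kappa> i) \<and> ?g (\<kappa> i) \<le> Max ?V" if "i \<in> I" "w i \<noteq> 0" for i
    using const[OF that(1)] supp[OF that] finite_gain_values[of F P J s]
    by (auto simp: gain_values_def intro!: Min_le Max_ge)
  then have "w i * Min ?V \<le> w i * ?g (\<kappa> i) \<and> w i * ?g (\<kappa> i) \<le> w i * Max ?V" if "i \<in> I" for i
    using that nonneg[OF that] by (cases "w i = 0") (auto intro: mult_left_mono)
  then have "(\<Sum>i\<in>I. w i * Min ?V) \<le> 0 \<and> 0 \<le> (\<Sum>i\<in>I. w i * Max ?V)"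
    unfolding zero[symmetric] by (auto intro: sum_mono)
  then show ?thesis using total by (simp flip: sum_distrib_right)
qed

section \<open>Arithmetic of the interval\<close>

lemma convex_combination_between:
  fixes l u m :: real
  assumes "l \<le> m" and "m \<le> u"
  obtains r where "0 \<le> r" "r \<le> 1" "m = (1 - r) * l + r * u"
proof (cases "l = u")
  case True
  then show thesis using that[of 0] assms by simp
next
  case False
  define r where "r = (m - l) / (u - l)"
  have "m - l = r * (u - l)" using False unfolding r_def by simp
  then have "m = (1 - r) * l + r * u" by (simp add: algebra_simps)
  moreover have "0 \<le> r" "r \<le> 1" using False assms unfolding r_def by auto
  ultimately show thesis using that by blast
qed

text \<open>Clearing the denominator removes the case distinctions. In the cases where it occurs,
  $y > 0$, and it is at least $y$; in the other cases the corresponding inequality already follows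
  from $0 \le z \le 1$.\<close>

lemma in_extension_interval_iff:
  fixes x y t z :: real
  assumes x: "x \<in> {0..1}" and y: "y \<in> {0..1}" and t: "t \<in> {0..1}"
  shows "z \<in> {lower_ext x y t..upper_ext x y t} \<longleftrightarrow>
    0 \<le> z \<and> z \<le> 1 \<and> t * (x + y - 1) \<le> z * (1 - t * (1 - y)) \<and>
    z * (1 - t * (1 - y)) \<le> 1 - t + t * x"
proof -
  define D where "D = 1 - t * (1 - y)"
  have D_ge: "y \<le> D"
    using mult_right_mono[of t 1 "1 - y"] t y unfolding D_def by simp
  have D_nonneg: "0 \<le> D" using D_ge y by simp
  have D_pos: "0 < D" if "0 < y" using D_ge that by simp
  have pos_factor: "0 < b" if "0 < t * b" for b using that t by (simp add: zero_less_mult_iff)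
  have lower: "lower_ext x y t \<le> z \<longleftrightarrow> 0 \<le> z \<and> t * (x + y - 1) \<le> z * D"
  proof (cases "t * (x + y - 1) \<le> 0")
    case True
    have "t * (x + y - 1) \<le> z * D" if "0 \<le> z"
      using True mult_nonneg_nonneg[OF that D_nonneg] by linarith
    then show ?thesis using True unfolding lower_ext_def by auto
  next
    case False
    then have "0 < D" using pos_factor[of "x + y - 1"] x D_pos by simp
    moreover have "0 \<le> z" if "t * (x + y - 1) \<le> z * D"
    proof -
      have "0 < z * D" using that False by linarith
      then show ?thesis using \<open>0 < D\<close> by (simp add: zero_less_mult_iff)
    qed
    ultimately show ?thesis using False
      unfolding lower_ext_def by (auto simp: pos_divide_le_eq D_def[symmetric])
  qed
  have D_eq: "D - t * (y - x) = 1 - t + t * x" unfolding D_def by (simp add: algebra_simps)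
  have upper: "z \<le> upper_ext x y t \<longleftrightarrow> z \<le> 1 \<and> z * D \<le> 1 - t + t * x"
  proof (cases "t * (y - x) \<le> 0")
    case True
    have "z * D \<le> D" if "z \<le> 1" using mult_right_mono[OF that D_nonneg] by simp
    then show ?thesis using True D_eq unfolding upper_ext_def by auto
  next
    case False
    then have "0 < D" using pos_factor[of "y - x"] x D_pos by simp
    have "z \<le> 1 - t * (y - x) / D \<longleftrightarrow> z * D \<le> D - t * (y - x)"
      using \<open>0 < D\<close> by (simp add: field_simps)
    moreover have "z \<le> 1" if "z * D \<le> D - t * (y - x)"
    proof -
      have "z * D \<le> 1 * D" using that False by simp
      then show ?thesis using \<open>0 < D\<close> by simp
    qed
    ultimately show ?thesis using False D_eq
      unfolding upper_ext_def D_def[symmetric] by auto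
  qed
  show ?thesis using lower upper unfolding D_def by auto
qed

section \<open>Distributions on the truth patterns\<close>

text \<open>The distribution on $A \vee B$ described by $P(B) = t$, $P(C|B) = x$, $P(A|B) = y$,
  $P(AC|B) = q$ and $P(C|A\overline{B}) = r$; the arguments are the truth values of $A$, $B$,
  $C$.\<close>

fun pattern_weight ::
  "real \<Rightarrow> real \<Rightarrow> real \<Rightarrow> real \<Rightarrow> real \<Rightarrow> bool \<times> bool \<times> bool \<Rightarrow> real" where
  "pattern_weight x y t q r (a, b, c) =
    (if b then t * (if a then if c then q else y - q
                    else if c then x - q else 1 - x - y + q)
     else if a then (1 - t) * (if c then r else 1 - r)
     else 0)"

lemma sum_truth_patterns:
  fixes f :: "bool \<times> bool \<times> bool \<Rightarrow> real"
  shows "sum f UNIV = (\<Sum>a\<in>UNIV. \<Sum>b\<in>UNIV. \<Sum>c\<in>UNIV. f (a, b, c))"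
  by (simp add: sum.cartesian_product split_def)

lemma pattern_weight_sums:
  fixes x y t q r p :: real
  defines "w \<equiv> pattern_weight x y t q r"
  shows "sum w UNIV = 1"
    and "(\<Sum>i\<in>UNIV. w i * (case i of (a, b, c) \<Rightarrow> of_bool b * (of_bool c - x))) = 0"
    and "(\<Sum>i\<in>UNIV. w i * (case i of (a, b, c) \<Rightarrow> of_bool b * (of_bool a - y))) = 0"
    and "(\<Sum>i\<in>UNIV. w i * (case i of (a, b, c) \<Rightarrow> of_bool (a \<or> b) * (of_bool b - p))) = t - p"
    and "(\<Sum>i\<in>UNIV. w i * (case i of (a, b, c) \<Rightarrow> of_bool a * (of_bool c - p))) =
      t * q + (1 - t) * r - p * (1 - t * (1 - y))"
  unfolding w_def by (simp_all add: sum_truth_patterns UNIV_bool algebra_simps)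

lemma pattern_weight_nonneg:
  assumes "t \<in> {0..1}" and "r \<in> {0..1}"
    and "max 0 (x + y - 1) \<le> q" and "q \<le> min x y"
  shows "0 \<le> pattern_weight x y t q r i"
  using assms by (cases i) auto

text \<open>One parameter moves $q$ through its interval and $r$ through $[0,1]$ at the same time, from
  the values that make $C|A$ least probable to those that make it most probable.\<close>

lemma attain_probability_given_A:
  fixes x y t z :: real
  assumes x: "x \<in> {0..1}" and y: "y \<in> {0..1}" and t: "t \<in> {0..1}" and z: "z \<in> {0..1}"
    and low: "t * (x + y - 1) \<le> z * (1 - t * (1 - y))"
    and up: "z * (1 - t * (1 - y)) \<le> 1 - t + t * x"
  obtains q r where "max 0 (x + y - 1) \<le> q" "q \<le> min x y" "r \<in> {0..1}"
    "t * q + (1 - t) * r = z * (1 - t * (1 - y))"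
proof -
  define l u D where "l = max 0 (x + y - 1)" and "u = min x y" and "D = 1 - t * (1 - y)"
  have "t * (1 - y) \<le> 1" using mult_mono[of t 1 "1 - y" 1] t y by simp
  then have "0 \<le> z * D" using z unfolding D_def by simp
  then have "t * l \<le> z * D" using low unfolding l_def D_def by (auto simp: max_def)
  moreover have "z * D \<le> D"
    using mult_right_mono[of z 1 D] z \<open>t * (1 - y) \<le> 1\<close> unfolding D_def by simp
  then have "z * D \<le> t * u + (1 - t)"
    using up unfolding u_def D_def by (auto simp: min_def algebra_simps)
  ultimately obtain r where r: "0 \<le> r" "r \<le> 1"
      and eq: "z * D = (1 - r) * (t * l) + r * (t * u + (1 - t))"
    by (rule convex_combination_between)
  have "l \<le> u" using x y unfolding l_def u_def by auto
  define q where "q = l + r * (u - l)"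
  have "0 \<le> r * (u - l)" "r * (u - l) \<le> 1 * (u - l)"
    using r \<open>l \<le> u\<close> by (simp, intro mult_right_mono) auto
  then have "l \<le> q" "q \<le> u" unfolding q_def by auto
  moreover have "t * q + (1 - t) * r = z * D" unfolding eq q_def by (simp add: algebra_simps)
  ultimately show thesis using that r unfolding l_def u_def D_def by simp
qed

section \<open>Coherent extensions\<close>

theorem theorem9:
  fixes A B C :: "'a::boolean_algebra"
    and x y t z :: real
  assumes "logically_independent3 A B C"
    and "x \<in> {0..1}" and "y \<in> {0..1}" and "t \<in> {0..1}"
  shows "coherent [C given B, A given B, B given (sup A B), C given A] [x, y, t, z]
     \<longleftrightarrow> z \<in> {lower_ext x y t..upper_ext x y t}"
proof -
  let ?F = "[C given B, A given B, B given (sup A B), C given A]" and ?P = "[x, y, t, z]"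
  define D where "D = 1 - t * (1 - y)"
  define Es where "Es = map consequent ?F @ map antecedent ?F"
  have const: "family_constituents ?F = constituents Es"
    unfolding family_constituents_def Es_def ..
  have mem: "{A, B, C} \<subseteq> set Es" unfolding Es_def by simp
  have le_sup: "K \<le> sup A B \<longleftrightarrow> K \<le> A \<or> K \<le> B" if "K \<in> family_constituents ?F" for K
    using that mem constituent_le_sup_iff[of K Es A B] unfolding const by blast
  have below4: "{..<length ?F} = {0, 1, 2, 3}" by auto
  have "coherent ?F ?P \<longleftrightarrow> 0 \<le> z \<and> z \<le> 1 \<and> t * (x + y - 1) \<le> z * D \<and> z * D \<le> 1 - t + t * x"
  proof
    assume coh: "coherent ?F ?P"
    have "z \<le> 1"
      by (rule coherent_gain_not_positive[OF coh, of "{3}" "\<lambda>_. -1"])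
        (auto simp: gain_def ind_def of_bool_def split: if_splits)
    moreover have "0 \<le> z"
      by (rule coherent_gain_not_positive[OF coh, of "{3}" "\<lambda>_. 1"])
        (auto simp: gain_def ind_def of_bool_def split: if_splits)
    moreover have "t * (x + y - 1) \<le> z * D"
    proof -
      \<comment> \<open>With these stakes the gain is $AC - BC - AB + B - (zD - t(x+y-1))$ on $A \vee B$. The
        stake on $B|(A \vee B)$ collects the multiples of $B$ left over after the conjunctions
        have been replaced by their prices and $A$ by $1 - B + AB$.\<close>
      define s where "s = (!) [-1, z - 1, 1 - x - y - z * (1 - y), 1]"
      obtain K where K: "K \<in> family_constituents ?F" "\<exists>j\<in>{0, 1, 2, 3}. K \<le> antecedent (?F ! j)"
          and G: "gain ?F ?P {0, 1, 2, 3} s K \<le> 0"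
        by (rule coherent_gain_not_positive[OF coh, of "{0, 1, 2, 3}" s]) auto
      have "K \<le> A \<or> K \<le> B" using K le_sup[OF K(1)] by auto
      then show ?thesis using G le_sup[OF K(1)]
        by (cases "K \<le> A"; cases "K \<le> B"; cases "K \<le> C")
          (simp_all add: gain_def ind_def s_def D_def algebra_simps)
    qed
    moreover have "z * D \<le> 1 - t + t * x"
    proof -
      \<comment> \<open>Here the gain is $BC + 1 - B - AC - (1 - t + tx - zD)$ on $A \vee B$.\<close>
      define s where "s = (!) [1, - z, x - 1 + z * (1 - y), -1]"
      obtain K where K: "K \<in> family_constituents ?F" "\<exists>j\<in>{0, 1, 2, 3}. K \<le> antecedent (?F ! j)"
          and G: "gain ?F ?P {0, 1, 2, 3} s K \<le> 0"
        by (rule coherent_gain_not_positive[OF coh, of "{0, 1, 2, 3}" s]) auto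
      have "K \<le> A \<or> K \<le> B" using K le_sup[OF K(1)] by auto
      then show ?thesis using G le_sup[OF K(1)]
        by (cases "K \<le> A"; cases "K \<le> B"; cases "K \<le> C")
          (simp_all add: gain_def ind_def s_def D_def algebra_simps)
    qed
    ultimately show "0 \<le> z \<and> z \<le> 1 \<and> t * (x + y - 1) \<le> z * D \<and> z * D \<le> 1 - t + t * x"
      by blast
  next
    assume bounds: "0 \<le> z \<and> z \<le> 1 \<and> t * (x + y - 1) \<le> z * D \<and> z * D \<le> 1 - t + t * x"
    then obtain q r where q: "max 0 (x + y - 1) \<le> q" "q \<le> min x y" and r: "r \<in> {0..1}"
        and mix: "t * q + (1 - t) * r = z * (1 - t * (1 - y))"
      using attain_probability_given_A[OF assms(2-4), of z] unfolding D_def by auto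
    have "\<exists>K. K \<in> family_constituents ?F \<and>
        (case i of (a, b, c) \<Rightarrow> (K \<le> A \<longleftrightarrow> a) \<and> (K \<le> B \<longleftrightarrow> b) \<and> (K \<le> C \<longleftrightarrow> c))" for i
    proof (cases i)
      case (fields a b c)
      obtain K where "K \<in> constituents Es" "K \<le> A \<longleftrightarrow> a" "K \<le> B \<longleftrightarrow> b" "K \<le> C \<longleftrightarrow> c"
        by (rule constituent_with_pattern[OF assms(1) mem])
      then show ?thesis unfolding const fields by auto
    qed
    then obtain \<kappa> where \<kappa>: "\<kappa> i \<in> family_constituents ?F"
        "case i of (a, b, c) \<Rightarrow> (\<kappa> i \<le> A \<longleftrightarrow> a) \<and> (\<kappa> i \<le> B \<longleftrightarrow> b) \<and> (\<kappa> i \<le> C \<longleftrightarrow> c)" for i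
      by metis
    have pattern: "\<kappa> (a, b, c) \<le> A \<longleftrightarrow> a" "\<kappa> (a, b, c) \<le> B \<longleftrightarrow> b" "\<kappa> (a, b, c) \<le> C \<longleftrightarrow> c"
        "\<kappa> (a, b, c) \<le> sup A B \<longleftrightarrow> a \<or> b" for a b c
      using \<kappa>(2)[of "(a, b, c)"] le_sup[OF \<kappa>(1)] by auto
    have inds: "ind A (\<kappa> i) = (case i of (a, b, c) \<Rightarrow> of_bool a)"
        "ind B (\<kappa> i) = (case i of (a, b, c) \<Rightarrow> of_bool b)"
        "ind C (\<kappa> i) = (case i of (a, b, c) \<Rightarrow> of_bool c)"
        "ind (sup A B) (\<kappa> i) = (case i of (a, b, c) \<Rightarrow> of_bool (a \<or> b))" for i
      by (cases i; simp add: ind_def pattern)+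
    have means:
        "(\<Sum>i\<in>UNIV. pattern_weight x y t' q r' i * (ind B (\<kappa> i) * (ind C (\<kappa> i) - x))) = 0"
        "(\<Sum>i\<in>UNIV. pattern_weight x y t' q r' i * (ind B (\<kappa> i) * (ind A (\<kappa> i) - y))) = 0"
        "(\<Sum>i\<in>UNIV. pattern_weight x y t' q r' i * (ind (sup A B) (\<kappa> i) * (ind B (\<kappa> i) - t))) = t' - t"
        "(\<Sum>i\<in>UNIV. pattern_weight x y t' q r' i * (ind A (\<kappa> i) * (ind C (\<kappa> i) - z))) =
          t' * q + (1 - t') * r' - z * (1 - t' * (1 - y))" for t' r'
      using pattern_weight_sums(2-5)[of x y t' q r'] unfolding inds
      by (simp_all add: case_prod_unfold)
    have signs: "Min (gain_values ?F ?P J s) \<le> 0 \<and> 0 \<le> Max (gain_values ?F ?P J s)"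
      if t': "t' \<in> {0..1}" and r': "r' \<in> {0..1}"
        and supp: "\<And>i. pattern_weight x y t' q r' i \<noteq> 0 \<Longrightarrow> \<exists>j\<in>J. \<kappa> i \<le> antecedent (?F ! j)"
        and J: "J \<subseteq> {0, 1, 2, 3}" and "2 \<in> J \<Longrightarrow> t' = t"
        and "3 \<in> J \<Longrightarrow> t' * q + (1 - t') * r' = z * (1 - t' * (1 - y))" for J s t' r'
    proof (rule gain_sign_if_mean_zero[of UNIV "pattern_weight x y t' q r'" \<kappa>])
      show "(\<Sum>i\<in>UNIV. pattern_weight x y t' q r' i * (ind (antecedent (?F ! j)) (\<kappa> i) *
          (ind (consequent (?F ! j)) (\<kappa> i) - ?P ! j))) = 0" if "j \<in> J" for j
      proof -
        have "j = 0 \<or> j = 1 \<or> j = 2 \<or> j = 3" using that J by auto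
        then show ?thesis using that \<open>2 \<in> J \<Longrightarrow> t' = t\<close>
            \<open>3 \<in> J \<Longrightarrow> t' * q + (1 - t') * r' = z * (1 - t' * (1 - y))\<close>
          by (elim disjE) (simp_all add: means)
      qed
    qed (use pattern_weight_nonneg[OF t' r' q] \<kappa>(1) supp pattern_weight_sums(1) in auto)
    show "coherent ?F ?P"
      unfolding coherent_def
    proof (intro conjI allI impI)
      show "\<forall>X\<in>set ?F. antecedent X \<noteq> bot"
        using assms(1) unfolding logically_independent3_def by (auto simp: sup_eq_bot_iff)
    next
      fix J s assume "J \<noteq> {} \<and> J \<subseteq> {..<length ?F}"
      then have "J \<noteq> {}" and J: "J \<subseteq> {0, 1, 2, 3}" unfolding below4 by auto
      consider (B) "J \<subseteq> {0, 1}" | (A) "J = {3}" | (AB) "2 \<in> J \<or> 3 \<in> J \<and> (0 \<in> J \<or> 1 \<in> J)"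
        using J by fastforce
      then have "Min (gain_values ?F ?P J s) \<le> 0 \<and> 0 \<le> Max (gain_values ?F ?P J s)"
      proof cases
        \<comment> \<open>All weight lies on $B$, which is the union of the antecedents.\<close>
        case B
        have "\<exists>j\<in>J. \<kappa> i \<le> antecedent (?F ! j)" if "pattern_weight x y 1 q r i \<noteq> 0" for i
        proof -
          have "\<kappa> i \<le> B" using that by (cases i) (auto simp: pattern split: if_splits)
          then show ?thesis using B \<open>J \<noteq> {}\<close> by fastforce
        qed
        then show ?thesis using B r J by (intro signs[of 1 r]) auto
      next
        \<comment> \<open>All weight lies on $A\overline{B}$, where $C$ has conditional probability $z$.\<close>
        case A
        have "\<exists>j\<in>J. \<kappa> i \<le> antecedent (?F ! j)" if "pattern_weight x y 0 q z i \<noteq> 0" for i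
        proof -
          have "\<kappa> i \<le> A" using that by (cases i) (auto simp: pattern split: if_splits)
          then show ?thesis using A by simp
        qed
        then show ?thesis using A bounds by (intro signs[of 0 z]) auto
      next
        case AB
        have "\<exists>j\<in>J. \<kappa> i \<le> antecedent (?F ! j)" if "pattern_weight x y t q r i \<noteq> 0" for i
        proof -
          have *: "\<kappa> i \<le> A \<or> \<kappa> i \<le> B"
            using that by (cases i) (auto simp: pattern split: if_splits)
          show ?thesis
          proof (cases "2 \<in> J")
            case True
            then show ?thesis using * le_sup[OF \<kappa>(1)] by (intro bexI[of _ 2]) auto
          next
            case False
            have "antecedent (?F ! 0) = B" "antecedent (?F ! 1) = B" "antecedent (?F ! 3) = A"
              by simp_all
            then show ?thesis using * AB False by metis
          qed
        qed
        then show ?thesis using r J mix assms(4) by (intro signs[of t r]) auto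
      qed
      then show "Min (gain_values ?F ?P J s) \<le> 0" "0 \<le> Max (gain_values ?F ?P J s)" by auto
    qed simp
  qed
  then show ?thesis using in_extension_interval_iff[OF assms(2-4)] unfolding D_def by simp
qed

end
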